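(* Let $ABC$ be a triangle in the Euclidean plane, and let a square with center $O$ be inscribed in $\triangle ABC$ in the following way: the vertices of the square lie on the sides of the triangle, and two of them lie on the side $AB$. If $\angle ACO=\angle BCO$, then $CA=CB$ or $\angle ACB=90^\circ$.
   Context: Triangles are non-degenerate. Sides are segments. The square has vertices $M,N$ on side $AB$, vertex $P$ on side $BC$ and vertex $Q$ on side $AC$. The disjunction in the conclusion is not exclusive. *)

theory Defs
  imports "HOL-Analysis.Analysis"
begin

text \<open>Unoriented angle at the middle point \<open>V\<close>, in \<open>[0, pi]\<close>. If \<open>X = V\<close> or \<open>Y = V\<close>,
  division by zero yields the junk value \<open>pi / 2\<close>.\<close>

definition angle :: "'a::real_inner \<Rightarrow> 'a \<Rightarrow> 'a \<Rightarrow> real" where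
  "angle X V Y = arccos (((X - V) \<bullet> (Y - V)) / (norm (X - V) * norm (Y - V)))"

text \<open>Vertices in cyclic order. The condition \<open>M \<noteq> N\<close> excludes the one-point square,
  whose angles would be right angles only by the junk value above.\<close>

definition is_square :: "'a::real_inner \<Rightarrow> 'a \<Rightarrow> 'a \<Rightarrow> 'a \<Rightarrow> bool" where
  "is_square M N P Q \<longleftrightarrow> M \<noteq> N \<and>
     dist M N = dist N P \<and> dist N P = dist P Q \<and> dist P Q = dist Q M \<and>
     angle Q M N = pi / 2 \<and> angle M N P = pi / 2 \<and>
     angle N P Q = pi / 2 \<and> angle P Q M = pi / 2"

end

theory Submission
  imports Defs
begin

text \<open>
  Put the origin at \<open>C\<close>, write \<open>a, b\<close> for \<open>A, B\<close>, and let \<open>s\<close> be the ratio of the distance of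
  \<open>PQ\<close> from \<open>AB\<close> to the height of \<open>C\<close>, so that \<open>P = (1 - s) b\<close>, \<open>Q = (1 - s) a\<close> and
  \<open>M = a + m (b - a)\<close>. The center lies on the bisector at \<open>C\<close> iff its coefficients with respect to
  \<open>a, b\<close> are inversely proportional to the side lengths. Eliminating \<open>m\<close> by \<open>QM \<bottom> AB\<close> leaves a
  multiple of \<open>|a| - |b|\<close>. With \<open>D\<close> twice the area, \<open>|QM| = |MN|\<close> gives \<open>s D = (1 - s) |b - a|\<^sup>2\<close>,
  and the remaining factor becomes \<open>D = |a| |b| + a \<bullet> b\<close>, which forces \<open>a \<bullet> b = 0\<close> since
  \<open>D\<^sup>2 = (|a| |b| - a \<bullet> b) (|a| |b| + a \<bullet> b)\<close>.
\<close>

text \<open>Keeps the quotient where \<open>cos\<close> inverts \<open>arccos\<close>; for a zero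
  vector the quotient is 0.\<close>

lemma inner_div_norms_bounds:
  fixes x y :: "'a::real_inner"
  shows "-1 \<le> x \<bullet> y / (norm x * norm y)" "x \<bullet> y / (norm x * norm y) \<le> 1"
proof -
  have "\<bar>x \<bullet> y / (norm x * norm y)\<bar> \<le> 1"
    using Cauchy_Schwarz_ineq2[of x y]
    by (cases "norm x * norm y = 0") (simp_all add: abs_mult pos_divide_le_eq)
  then show "-1 \<le> x \<bullet> y / (norm x * norm y)" "x \<bullet> y / (norm x * norm y) \<le> 1"
    by linarith+
qed

lemma angle_eq_pi_half_iff: "angle X V Y = pi / 2 \<longleftrightarrow> (X - V) \<bullet> (Y - V) = 0"
proof
  assume "angle X V Y = pi / 2"
  then have "cos (angle X V Y) = 0" by (simp only: cos_pi_half)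
  then show "(X - V) \<bullet> (Y - V) = 0"
    unfolding angle_def using inner_div_norms_bounds[of "X - V" "Y - V"] by (auto simp: cos_arccos)
qed (simp add: angle_def)

text \<open>Equal angles have equal cosines, and the common factor \<open>norm (Z - V)\<close>
  cancels; if \<open>Z = V\<close>, both sides are 0.\<close>

lemma angle_eq_imp_inner_eq:
  assumes "angle X V Z = angle Y V Z" "X \<noteq> V" "Y \<noteq> V"
  shows "((X - V) \<bullet> (Z - V)) * norm (Y - V) = ((Y - V) \<bullet> (Z - V)) * norm (X - V)"
proof (cases "Z = V")
  case False
  have "cos (angle X V Z) = cos (angle Y V Z)" using assms(1) by simp
  then have "(X - V) \<bullet> (Z - V) / (norm (X - V) * norm (Z - V)) =
    (Y - V) \<bullet> (Z - V) / (norm (Y - V) * norm (Z - V))"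
    unfolding angle_def by (simp only: cos_arccos inner_div_norms_bounds)
  then show ?thesis using assms False by (simp add: field_simps)
qed simp

text \<open>The inner products at the four right angles add up to the squared norm of
  \<open>N - M + (Q - P)\<close>.\<close>

lemma is_square_parallelogram:
  assumes "is_square M N P Q"
  shows "N - M = P - Q"
proof -
  have "(Q - M) \<bullet> (N - M) = 0" "(M - N) \<bullet> (P - N) = 0"
       "(N - P) \<bullet> (Q - P) = 0" "(P - Q) \<bullet> (M - Q) = 0"
    using assms unfolding is_square_def angle_eq_pi_half_iff by auto
  then have "(N - M + (Q - P)) \<bullet> (N - M + (Q - P)) = 0"
    by (simp add: algebra_simps inner_commute)
  then have "N - M + (Q - P) = 0" by (simp only: inner_eq_zero_iff)
  then show ?thesis by (simp add: algebra_simps)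
qed

text \<open>Inner products with \<open>a\<close> and \<open>b\<close> give a linear system in
  \<open>r, s\<close> whose determinant, the Gram determinant, is nonzero by strict
  Cauchy-Schwarz.\<close>

lemma independent_if_inner_less:
  fixes a b :: "'a::real_inner"
  assumes "\<bar>a \<bullet> b\<bar> < norm a * norm b" "r *\<^sub>R a + s *\<^sub>R b = 0"
  shows "r = 0 \<and> s = 0"
proof -
  have "(a \<bullet> b)\<^sup>2 < (norm a * norm b)\<^sup>2"
    using assms(1) by (metis abs_ge_zero power2_abs power_strict_mono zero_less_numeral)
  then have *: "(a \<bullet> a) * (b \<bullet> b) - (a \<bullet> b)\<^sup>2 \<noteq> 0"
    by (simp add: power_mult_distrib power2_norm_eq_inner)
  have 1: "r * (a \<bullet> a) + s * (a \<bullet> b) = 0" and 2: "r * (a \<bullet> b) + s * (b \<bullet> b) = 0"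
    using arg_cong[OF assms(2), of "\<lambda>v. a \<bullet> v"] arg_cong[OF assms(2), of "\<lambda>v. b \<bullet> v"]
    by (simp_all add: inner_add_right inner_commute)
  have "r * ((a \<bullet> a) * (b \<bullet> b) - (a \<bullet> b)\<^sup>2) = 0" "s * ((a \<bullet> a) * (b \<bullet> b) - (a \<bullet> b)\<^sup>2) = 0"
    using 1 2 by algebra+
  then show ?thesis using * by simp
qed

text \<open>Here \<open>\<alpha>, \<beta>\<close> are the lengths of \<open>a, b\<close>, and \<open>c\<close> is their inner product. The
  assumptions \<open>bis\<close>, \<open>perp\<close> and \<open>len\<close> express the bisector condition, \<open>QM \<bottom> AB\<close> and
  \<open>|QM| = |MN|\<close>.\<close>

lemma bisector_equations:
  fixes \<alpha> \<beta> c m s :: real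
  assumes nd: "\<bar>c\<bar> < \<alpha> * \<beta>"
    and s: "0 \<le> s" "s \<le> 1"
    and bis: "((1 - m) * \<alpha>\<^sup>2 + (m + 1 - s) * c) * \<beta> = ((1 - m) * c + (m + 1 - s) * \<beta>\<^sup>2) * \<alpha>"
    and perp: "(s - m) * (c - \<alpha>\<^sup>2) + m * (\<beta>\<^sup>2 - c) = 0"
    and len: "(s - m)\<^sup>2 * \<alpha>\<^sup>2 + 2 * (s - m) * m * c + m\<^sup>2 * \<beta>\<^sup>2
      = (1 - s)\<^sup>2 * (\<alpha>\<^sup>2 + \<beta>\<^sup>2 - 2 * c)"
  shows "\<alpha> = \<beta> \<or> c = 0"
proof (cases "\<alpha> = \<beta>")
  case False
  \<comment> \<open>\<open>u\<close> is the squared length of \<open>AB\<close>.\<close>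
  define u where "u = \<alpha>\<^sup>2 + \<beta>\<^sup>2 - 2 * c"
  define D where "D = sqrt (\<alpha>\<^sup>2 * \<beta>\<^sup>2 - c\<^sup>2)"
  have "c\<^sup>2 < (\<alpha> * \<beta>)\<^sup>2"
    using nd by (metis abs_ge_zero power2_abs power_strict_mono zero_less_numeral)
  then have D2: "D\<^sup>2 = \<alpha>\<^sup>2 * \<beta>\<^sup>2 - c\<^sup>2" and D: "D \<ge> 0"
    by (simp_all add: D_def power_mult_distrib)
  have "u = (\<alpha> - \<beta>)\<^sup>2 + 2 * (\<alpha> * \<beta> - c)" by (simp add: u_def power2_eq_square algebra_simps)
  moreover have "c < \<alpha> * \<beta>" using nd by linarith
  ultimately have u: "u > 0" by (simp add: add_nonneg_pos)
  have m: "m * u = s * (\<alpha>\<^sup>2 - c)" using perp unfolding u_def by algebra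
  have "((1 - m) * \<alpha> - (m + 1 - s) * \<beta>) * (\<alpha> * \<beta> - c) = 0" using bis by algebra
  then have "(1 - m) * \<alpha> = (m + 1 - s) * \<beta>" using nd by auto
  \<comment> \<open>Multiply by \<open>u\<close> and replace \<open>m * u\<close>; the difference of
    cubes that arises supplies the factor \<open>\<alpha> - \<beta>\<close>.\<close>
  then have "(\<alpha> - \<beta>) * (u - s * (\<alpha>\<^sup>2 + \<alpha> * \<beta> + \<beta>\<^sup>2 - c)) = 0"
    using m unfolding u_def by algebra
  then have us: "u = s * (\<alpha>\<^sup>2 + \<alpha> * \<beta> + \<beta>\<^sup>2 - c)" using False by simp
  \<comment> \<open>The height of \<open>C\<close> over \<open>AB\<close> is
    \<open>D / sqrt u\<close>, so \<open>|QM| = s * D / sqrt u\<close>.\<close>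
  have "(s * D)\<^sup>2 = u * ((s - m)\<^sup>2 * \<alpha>\<^sup>2 + 2 * (s - m) * m * c + m\<^sup>2 * \<beta>\<^sup>2)"
    using m D2 unfolding u_def by algebra
  also have "\<dots> = ((1 - s) * u)\<^sup>2" unfolding len by (simp add: u_def power2_eq_square)
  finally have sD: "s * D = (1 - s) * u" using s D u by simp
  have "s \<noteq> 0" using us u by auto
  moreover have "s * (D + u) = s * (\<alpha>\<^sup>2 + \<alpha> * \<beta> + \<beta>\<^sup>2 - c)"
    using sD us by algebra
  ultimately have "D = \<alpha> * \<beta> + c" by (simp add: u_def)
  then have "(\<alpha> * \<beta> + c) * c = 0" using D2 by algebra
  then show ?thesis using nd by auto
qed simp

theorem mainTheorem2:
  fixes A B C M N P Q Ctr :: "real ^ 2"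
  assumes "\<not> collinear {A, B, C}"
    and "is_square M N P Q"
    and "M \<in> closed_segment A B" and "N \<in> closed_segment A B"
    and "P \<in> closed_segment B C" and "Q \<in> closed_segment A C"
    and "Ctr = midpoint M P"
    and "angle A C Ctr = angle B C Ctr"
  shows "dist C A = dist C B \<or> angle A C B = pi / 2"
proof -
  define a where "a = A - C"
  define b where "b = B - C"
  have "\<not> collinear {0, a, b}"
    using assms(1) collinear_3[of A C B] by (simp add: a_def b_def insert_commute)
  then have nd: "\<bar>a \<bullet> b\<bar> < norm a * norm b"
    using norm_cauchy_schwarz_equal[of a b] Cauchy_Schwarz_ineq2[of a b] by linarith
  obtain m where "M = (1 - m) *\<^sub>R A + m *\<^sub>R B" using assms(3) by (auto simp: in_segment)
  then have M: "M = C + (1 - m) *\<^sub>R a + m *\<^sub>R b"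
    by (simp add: a_def b_def algebra_simps)
  obtain n where "N = (1 - n) *\<^sub>R A + n *\<^sub>R B" using assms(4) by (auto simp: in_segment)
  then have N: "N = C + (1 - n) *\<^sub>R a + n *\<^sub>R b"
    by (simp add: a_def b_def algebra_simps)
  obtain s where s: "0 \<le> s" "s \<le> 1" and "P = (1 - s) *\<^sub>R B + s *\<^sub>R C"
    using assms(5) by (auto simp: in_segment)
  then have P: "P = C + (1 - s) *\<^sub>R b"
    by (simp add: b_def algebra_simps)
  obtain q where "Q = (1 - q) *\<^sub>R A + q *\<^sub>R C"
    using assms(6) by (auto simp: in_segment)
  then have Q: "Q = C + (1 - q) *\<^sub>R a"
    by (simp add: a_def algebra_simps)
  \<comment> \<open>Comparing coefficients in \<open>N - M = P - Q\<close> shows that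
    \<open>P\<close> and \<open>Q\<close> divide their sides in the same ratio.\<close>
  have "(m - n + 1 - q) *\<^sub>R a + (n - m - (1 - s)) *\<^sub>R b = 0"
    using is_square_parallelogram[OF assms(2)] unfolding M N P Q by (simp add: algebra_simps)
  from independent_if_inner_less[OF nd this] have n: "n = m + 1 - s" and q: "q = s" by auto
  have QM: "Q - M = - ((s - m) *\<^sub>R a + m *\<^sub>R b)"
    unfolding Q M q by (simp add: algebra_simps)
  have NM: "N - M = (1 - s) *\<^sub>R (b - a)"
    unfolding N M n by (simp add: algebra_simps)
  have "M \<noteq> N" and QMN: "(Q - M) \<bullet> (N - M) = 0" and "dist M N = dist Q M"
    using assms(2) unfolding is_square_def angle_eq_pi_half_iff by auto
  then have "norm (Q - M) = norm (N - M)" by (simp add: dist_norm norm_minus_commute)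
  then have QM2: "(Q - M) \<bullet> (Q - M) = (N - M) \<bullet> (N - M)" by (simp add: norm_eq)
  \<comment> \<open>This allows the factor \<open>1 - s\<close> of \<open>N - M\<close> to be
    cancelled in the orthogonality relation.\<close>
  have "1 - s \<noteq> 0" using NM \<open>M \<noteq> N\<close> by auto
  then have "((s - m) *\<^sub>R a + m *\<^sub>R b) \<bullet> (b - a) = 0"
    using QMN unfolding QM NM inner_minus_left inner_scaleR_right by simp
  then have perp: "(s - m) * (a \<bullet> b - (norm a)\<^sup>2) + m * ((norm b)\<^sup>2 - a \<bullet> b) = 0"
    by (simp add: power2_norm_eq_inner inner_diff_right inner_add_left inner_commute algebra_simps)
  have len: "(s - m)\<^sup>2 * (norm a)\<^sup>2 + 2 * (s - m) * m * (a \<bullet> b) + m\<^sup>2 * (norm b)\<^sup>2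
      = (1 - s)\<^sup>2 * ((norm a)\<^sup>2 + (norm b)\<^sup>2 - 2 * (a \<bullet> b))"
    using QM2 unfolding QM NM power2_norm_eq_inner
    by (simp add: inner_diff inner_add inner_commute power2_eq_square algebra_simps)
  have O: "Ctr - C = (1/2) *\<^sub>R ((1 - m) *\<^sub>R a + (m + 1 - s) *\<^sub>R b)"
  proof -
    have "2 *\<^sub>R (Ctr - C) = M + P - 2 *\<^sub>R C" by (simp add: assms(7) midpoint_def algebra_simps)
    also have "\<dots> = (1 - m) *\<^sub>R a + (m + 1 - s) *\<^sub>R b"
      unfolding M P by (simp add: algebra_simps scaleR_2)
    finally show ?thesis by (metis scaleR_half_double scaleR_2 scaleR_right_distrib)
  qed
  have "A \<noteq> C" "B \<noteq> C" using nd by (auto simp: a_def b_def)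
  from angle_eq_imp_inner_eq[OF assms(8) this]
  have "((1 - m) * (norm a)\<^sup>2 + (m + 1 - s) * (a \<bullet> b)) * norm b =
    ((1 - m) * (a \<bullet> b) + (m + 1 - s) * (norm b)\<^sup>2) * norm a"
    unfolding O a_def[symmetric] b_def[symmetric]
    by (simp add: inner_add_right power2_norm_eq_inner inner_commute[of b a])
  from bisector_equations[OF nd s this perp len]
  show ?thesis
    unfolding angle_eq_pi_half_iff a_def b_def dist_norm by (simp only: norm_minus_commute)
qed

end
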